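(* Let $G=(V,E)$ be a graph with boundary $B$. Suppose $D$ is the diameter of $G$ and $r$ is the inscribed radius of $(G,B)$. Let $\Omega=V\setminus B$ be the interior and assume it is connected. Then $$\lambda_1(G,B)\ \geq\ \frac{1}{r\,|\Omega|}\ \geq\ \frac{1}{D\,|\Omega|}.$$ This bound is sharp up to a constant factor.
   Context: Graphs are finite, undirected and simple. A graph with boundary is a pair $(G,B)$ where $G=(V,E)$ is a graph and $B\subset V$ is such that, with $\Omega:=V\setminus B$ (the interior), (i) $B$ is exactly the set of vertices outside $\Omega$ having at least one neighbor in $\Omega$, and (ii) no edge of $G$ joins two vertices of $B$. Both $B$ and $\Omega$ are non-empty. "$\Omega$ is connected" means that the subgraph induced on $\Omega$ is connected. The first Dirichlet eigenvalue $\lambda_1(G,B)$ is the smallest $\lambda$ for which there is a nonzero $f:V\to\mathbb{R}$ with $f=0$ on $B$ and $\sum_{y\sim x}(f(x)-f(y))=\lambda f(x)$ for all $x\in\Omega$. Equivalently, $\lambda_1(G,B)=\min \frac{\sum_{\{x,y\}\in E}(f(x)-f(y))^2}{\sum_{x\in\Omega}f(x)^2}$ over nonzero $f:V\to\mathbb{R}$ vanishing on $B$. The inscribed radius of $(G,B)$ is $r=\sup_{v\in V}\mathrm{dist}(v,B)$; the diameter of $G$ is $D=\sup_{v,w\in V}\mathrm{dist}(v,w)$. *)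

theory Defs
  imports Graph_Theory.Digraph_Component Graph_Theory.Shortest_Path
begin

text \<open>
  A finite simple undirected graph is the locale \<open>graph\<close> of Graph_Theory: a finite, loop-free
  digraph without parallel arcs whose adjacency relation is symmetric, so that each undirected
  edge is a pair of opposite arcs.
\<close>

definition interior_verts :: "('a, 'b) pre_digraph \<Rightarrow> 'a set \<Rightarrow> 'a set" where
  "interior_verts G B = verts G - B"

locale graph_with_boundary = graph G
  for G :: "('a, 'b) pre_digraph" (structure) +
  fixes B :: "'a set"
  assumes boundary_subset: "B \<subseteq> verts G"
    and boundary_nonempty: "B \<noteq> {}"
    and interior_nonempty: "interior_verts G B \<noteq> {}"
    and boundary_eq:
      "B = {v \<in> verts G. v \<notin> interior_verts G B \<and> (\<exists>w \<in> interior_verts G B. v \<rightarrow> w)}"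
    and boundary_independent: "\<And>u v. u \<in> B \<Longrightarrow> v \<in> B \<Longrightarrow> \<not> u \<rightarrow> v"

text \<open>Functions on the vertex set are total functions on the vertex type; their values outside
  \<open>verts G\<close> are never used.\<close>

definition dirichlet_eigenvalue :: "('a, 'b) pre_digraph \<Rightarrow> 'a set \<Rightarrow> real \<Rightarrow> bool" where
  "dirichlet_eigenvalue G B l \<longleftrightarrow>
    (\<exists>f :: 'a \<Rightarrow> real.
      (\<exists>x \<in> verts G. f x \<noteq> 0) \<and>
      (\<forall>x \<in> B. f x = 0) \<and>
      (\<forall>x \<in> interior_verts G B. (\<Sum>y \<in> {y. x \<rightarrow>\<^bsub>G\<^esub> y}. f x - f y) = l * f x))"

definition first_dirichlet_eigenvalue :: "('a, 'b) pre_digraph \<Rightarrow> 'a set \<Rightarrow> real" where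
  "first_dirichlet_eigenvalue G B = (LEAST l. dirichlet_eigenvalue G B l)"

text \<open>The distance is the library's shortest-path cost with unit weights; it is \<open>\<infinity>\<close> between
  different components.\<close>

definition graph_dist :: "('a, 'b) pre_digraph \<Rightarrow> 'a \<Rightarrow> 'a \<Rightarrow> ereal" where
  "graph_dist G u v = wf_digraph.\<mu> G (\<lambda>_. 1) u v"

definition inscribed_radius :: "('a, 'b) pre_digraph \<Rightarrow> 'a set \<Rightarrow> ereal" where
  "inscribed_radius G B = (SUP v \<in> verts G. INF b \<in> B. graph_dist G v b)"

definition graph_diameter :: "('a, 'b) pre_digraph \<Rightarrow> ereal" where
  "graph_diameter G = (SUP v \<in> verts G. SUP w \<in> verts G. graph_dist G v w)"

end

theory Submission
  imports Defs "HOL-Analysis.Function_Topology" "HOL-Analysis.Convex"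
begin

text \<open>
  The Rayleigh quotient attains its minimum by compactness, and the first variation shows that the
  minimum is an eigenvalue, hence the least one. Let \<open>f\<close> be an eigenfunction for it and \<open>v\<close> an
  interior vertex where \<open>\<bar>f\<bar>\<close> is maximal. Cauchy-Schwarz along a shortest path from \<open>v\<close> to the
  boundary bounds \<open>(f v)\<^sup>2\<close> by \<open>r\<close> times the Dirichlet energy of \<open>f\<close>, whereas its \<open>L\<^sup>2\<close> norm squared
  is at most \<open>(f v)\<^sup>2\<close> times the number of interior vertices. For sharpness, attach all superfluous
  vertices as leaves to the far end of a path of length \<open>r - 1\<close> starting at the boundary, and take
  the function that is linear on the path and constant on the leaves.
\<close>

section \<open>Laplacian, Dirichlet form and Green's formula\<close>

definition laplacian :: "('a, 'b) pre_digraph \<Rightarrow> ('a \<Rightarrow> real) \<Rightarrow> 'a \<Rightarrow> real" where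
  "laplacian G f x = (\<Sum>y\<in>{y. x \<rightarrow>\<^bsub>G\<^esub> y}. f x - f y)"

text \<open>Each undirected edge occurs in \<open>arcs_ends G\<close> in both orientations, hence
  the factor 1/2. The bilinear version is what the first variation requires.\<close>

definition dirichlet_form :: "('a, 'b) pre_digraph \<Rightarrow> ('a \<Rightarrow> real) \<Rightarrow> ('a \<Rightarrow> real) \<Rightarrow> real" where
  "dirichlet_form G f g = (\<Sum>(x, y)\<in>arcs_ends G. (f x - f y) * (g x - g y)) / 2"

lemma dirichlet_form_nonneg: "0 \<le> dirichlet_form G f f"
  unfolding dirichlet_form_def by (intro divide_nonneg_pos sum_nonneg) auto

lemma dirichlet_form_add_scale:
  "dirichlet_form G (\<lambda>x. f x + t * g x) (\<lambda>x. f x + t * g x)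
    = dirichlet_form G f f + 2 * t * dirichlet_form G f g + t\<^sup>2 * dirichlet_form G g g"
  unfolding dirichlet_form_def times_divide_eq_right sum_distrib_left
    add_divide_distrib[symmetric] sum.distrib[symmetric]
  by (intro arg_cong2[where f = "(/)"] sum.cong)
    (auto simp: algebra_simps power2_eq_square)

lemma dirichlet_form_scale:
  "dirichlet_form G (\<lambda>x. c * f x) (\<lambda>x. c * f x) = c\<^sup>2 * dirichlet_form G f f"
  unfolding dirichlet_form_def times_divide_eq_right sum_distrib_left
  by (intro arg_cong2[where f = "(/)"] sum.cong)
    (auto simp: algebra_simps power2_eq_square)

lemma (in fin_digraph) finite_arcs_ends: "finite (arcs_ends G)"
  by (simp add: arcs_ends_def)

lemma (in sym_digraph) sum_arcs_ends_swap:
  "(\<Sum>(x, y)\<in>arcs_ends G. h y x) = (\<Sum>(x, y)\<in>arcs_ends G. h x y)"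
  by (rule sum.reindex_bij_witness[of _ prod.swap prod.swap])
    (auto intro: arcs_ends_symmetric[OF sym_arcs])

text \<open>Green's formula: reversing all arcs turns \<open>g x * (f x - f y)\<close> into
  \<open>g y * (f y - f x)\<close>, and the average of the two is half the product of the
  differences.\<close>

lemma (in pseudo_graph) sum_mult_laplacian:
  "(\<Sum>x\<in>verts G. g x * laplacian G f x) = dirichlet_form G f g"
proof -
  have fin: "finite {y. x \<rightarrow> y}" for x
    by (rule finite_subset[of _ "verts G"]) (auto dest: adj_in_verts)
  have A: "(SIGMA x:verts G. {y. x \<rightarrow> y}) = arcs_ends G"
    by (auto dest: adj_in_verts)
  have 1: "(\<Sum>x\<in>verts G. g x * laplacian G f x) = (\<Sum>(x, y)\<in>arcs_ends G. g x * (f x - f y))"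
    unfolding laplacian_def sum_distrib_left by (subst sum.Sigma) (auto simp: A fin)
  have 2: "\<dots> = (\<Sum>(x, y)\<in>arcs_ends G. g y * (f y - f x))"
    using sum_arcs_ends_swap[of "\<lambda>x y. g x * (f x - f y)"] by simp
  have 3: "dirichlet_form G f g * 2
      = (\<Sum>(x, y)\<in>arcs_ends G. g x * (f x - f y)) + (\<Sum>(x, y)\<in>arcs_ends G. g y * (f y - f x))"
    unfolding dirichlet_form_def sum.distrib[symmetric]
    by (auto intro!: sum.cong simp: algebra_simps)
  show ?thesis using 1 2 3 by simp
qed

text \<open>Taking positive parts counts every undirected edge exactly once.\<close>

lemma (in sym_digraph) dirichlet_form_positive_part:
  "dirichlet_form G f f = (\<Sum>(x, y)\<in>arcs_ends G. (max 0 (f x - f y))\<^sup>2)" (is "_ = ?P")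
proof -
  have "2 * ?P = ?P + (\<Sum>(x, y)\<in>arcs_ends G. (max 0 (f y - f x))\<^sup>2)"
    using sum_arcs_ends_swap[of "\<lambda>x y. (max 0 (f x - f y))\<^sup>2"] by simp
  also have "\<dots> = (\<Sum>(x, y)\<in>arcs_ends G. (f x - f y) * (f x - f y))"
    unfolding sum.distrib[symmetric]
    by (intro sum.cong) (auto simp: max_def power2_eq_square algebra_simps)
  finally show ?thesis by (simp add: dirichlet_form_def)
qed

section \<open>Path lengths and the energy along a path\<close>

lemma (in wf_digraph) awalk_cost_one: "awalk_cost (\<lambda>_. 1) p = real (length p)"
  by (simp add: awalk_cost_def sum_list_triv)

text \<open>Unit weights admit no negative cycle, so the minimal cost is attained on a path whenever
  \<open>v\<close> is reachable; otherwise the distance is infinite.\<close>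

lemma (in fin_digraph) graph_dist_ge:
  assumes "\<And>p. apath u p v \<Longrightarrow> c \<le> real (length p)"
  shows "ereal c \<le> graph_dist G u v"
proof (cases "u \<rightarrow>\<^sup>* v")
  case True
  then obtain p where "apath u p v" "\<mu> (\<lambda>_. 1) u v = awalk_cost (\<lambda>_. 1) p"
    using min_cost_awalk[of u v "\<lambda>_. 1"] by auto
  then show ?thesis using assms by (simp add: graph_dist_def awalk_cost_one)
qed (simp add: graph_dist_def shortest_path_inf)

text \<open>The differences telescope along the walk, and discarding the negative ones only enlarges
  the sum.\<close>

lemma (in wf_digraph) awalk_diff_le:
  assumes "awalk u p v"
  shows "(f u :: real) - f v \<le> (\<Sum>a\<leftarrow>p. max 0 (f (tail G a) - f (head G a)))"
  using assms
proof (induction p arbitrary: u)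
  case (Cons a p)
  then show ?case using Cons.IH[of "head G a"] by (fastforce simp: awalk_Cons_iff)
qed (auto simp: awalk_Nil_iff)

text \<open>Cauchy-Schwarz on the distinct arcs of the path. With positive parts the sum over all
  arcs is exactly the energy; full squares would count every edge twice and lose a factor 2.\<close>

lemma (in graph) apath_diff_squared_le_pos:
  assumes p: "apath u p v" and uv: "f v \<le> f u"
  shows "(f u - f v)\<^sup>2 \<le> real (length p) * dirichlet_form G f f"
proof -
  define h where "h a = max 0 (f (tail G a) - f (head G a))" for a
  have aw: "awalk u p v" and d: "distinct p"
    using p by (auto simp: apath_def distinct_verts_imp_distinct)
  have "f u - f v \<le> (\<Sum>a\<in>set p. h a)"
    using awalk_diff_le[OF aw, of f] unfolding h_def[symmetric]
    by (simp add: sum_list_distinct_conv_sum_set[OF d])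
  then have "(f u - f v)\<^sup>2 \<le> (\<Sum>a\<in>set p. h a)\<^sup>2"
    using uv by (intro power_mono) auto
  also have "\<dots> \<le> real (length p) * (\<Sum>a\<in>set p. (h a)\<^sup>2)"
    using sum_squared_le_sum_of_squares[of h "set p"] distinct_card[OF d]
    by (simp add: mult.commute)
  also have "(\<Sum>a\<in>set p. (h a)\<^sup>2) \<le> (\<Sum>a\<in>arcs G. (h a)\<^sup>2)"
    using aw by (intro sum_mono2) auto
  \<comment> \<open>Without parallel arcs, arcs correspond bijectively to their pairs of
    ends.\<close>
  also have "\<dots> = dirichlet_form G f f"
    unfolding dirichlet_form_positive_part arcs_ends_def h_def
    by (subst sum.reindex[OF inj_on_arc_to_ends]) (simp add: arc_to_ends_def)
  finally show ?thesis by (simp add: mult_left_mono)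
qed

text \<open>The case of increasing values follows by passing to \<open>-f\<close>, which has the
  same energy.\<close>

lemma (in graph) apath_diff_squared_le:
  assumes p: "apath u p v"
  shows "(f u - f v)\<^sup>2 \<le> real (length p) * dirichlet_form G f f"
proof (cases "f v \<le> f u")
  case False
  then show ?thesis
    using apath_diff_squared_le_pos[OF p, of "\<lambda>x. -1 * f x"]
    unfolding dirichlet_form_scale by (simp add: power2_commute)
qed (use apath_diff_squared_le_pos[OF p] in blast)

section \<open>Existence and variational characterisation of the first eigenvalue\<close>

lemma linear_coeff_zero:
  fixes a b :: real
  assumes "\<And>t. 0 \<le> 2 * t * a + t\<^sup>2 * b"
  shows "a = 0"
proof -
  \<comment> \<open>Replacing \<open>b\<close> by a positive upper bound makes the minimiser
    \<open>- a / c\<close> of the quadratic available for every sign of \<open>b\<close>; the value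
    there is \<open>- (a\<^sup>2 / c)\<close>.\<close>
  define c where "c = \<bar>b\<bar> + 1"
  have c: "0 < c" "b \<le> c" by (auto simp: c_def)
  define t where "t = - a / c"
  have "2 * t * a + t\<^sup>2 * b \<le> 2 * t * a + t\<^sup>2 * c"
    using c by (intro add_left_mono mult_left_mono) auto
  also have "\<dots> = - (a\<^sup>2 / c)"
    using c(1) unfolding t_def by (simp add: field_simps power2_eq_square)
  finally have "a\<^sup>2 / c \<le> 0"
    using assms[of t] by simp
  then show ?thesis using c(1) by (simp add: divide_le_0_iff)
qed

context graph_with_boundary
begin

abbreviation \<Omega> where "\<Omega> \<equiv> interior_verts G B"

lemma finite_interior: "finite \<Omega>"
  by (simp add: interior_verts_def)

lemma card_interior_pos: "0 < card \<Omega>"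
  using finite_interior interior_nonempty by (simp add: card_gt_0_iff)

lemma sum_interior:
  assumes "\<And>x. x \<in> B \<Longrightarrow> h x = (0::real)"
  shows "(\<Sum>x\<in>verts G. h x) = (\<Sum>x\<in>\<Omega>. h x)"
  using assms by (intro sum.mono_neutral_right) (auto simp: interior_verts_def)

text \<open>Functions live on a possibly infinite type, so compactness is taken in the product
  topology: the sphere is a closed subset of a product of intervals (over \<Omega>) and single
  points (elsewhere), which is compact by Tychonoff.\<close>

lemma compact_unit_sphere:
  "compact {f :: 'a \<Rightarrow> real. (\<forall>x. x \<notin> \<Omega> \<longrightarrow> f x = 0) \<and> (\<Sum>x\<in>\<Omega>. (f x)\<^sup>2) = 1}" (is "compact ?K")
proof -
  let ?C = "PiE UNIV (\<lambda>x. if x \<in> \<Omega> then {-1..1::real} else {0})"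
  have "compact ?C"
    unfolding compactin_euclidean_iff[symmetric] euclidean_product_topology[symmetric] compactin_PiE
    by auto
  moreover have "closed {f :: 'a \<Rightarrow> real. (\<Sum>x\<in>\<Omega>. (f x)\<^sup>2) = 1}"
    by (intro closed_Collect_eq continuous_intros continuous_on_product_coordinates)
  ultimately have "compact (?C \<inter> {f. (\<Sum>x\<in>\<Omega>. (f x)\<^sup>2) = 1})"
    by (rule compact_Int_closed)
  moreover have "\<bar>f x\<bar> \<le> 1" if "(\<Sum>x\<in>\<Omega>. (f x)\<^sup>2) = 1" "x \<in> \<Omega>" for f :: "'a \<Rightarrow> real" and x
  proof -
    have "(f x)\<^sup>2 \<le> 1"
      using member_le_sum[of x \<Omega> "\<lambda>x. (f x)\<^sup>2"] that finite_interior by auto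
    then show ?thesis by (simp add: abs_square_le_1)
  qed
  then have "?K = ?C \<inter> {f. (\<Sum>x\<in>\<Omega>. (f x)\<^sup>2) = 1}"
    by (fastforce simp: PiE_iff abs_le_iff split: if_splits)
  ultimately show ?thesis by simp
qed

text \<open>Homogeneity extends the minimum on the sphere to all admissible \<open>g\<close>. The
  product form of the inequality also covers those \<open>g\<close> that vanish on \<Omega>.\<close>

lemma rayleigh_minimizer:
  obtains f where "\<And>x. x \<notin> \<Omega> \<Longrightarrow> f x = 0" "(\<Sum>x\<in>\<Omega>. (f x)\<^sup>2) = 1"
    "\<And>g. (\<And>x. x \<in> B \<Longrightarrow> g x = 0) \<Longrightarrow>
      dirichlet_form G f f * (\<Sum>x\<in>\<Omega>. (g x)\<^sup>2) \<le> dirichlet_form G g g"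
proof -
  let ?K = "{f :: 'a \<Rightarrow> real. (\<forall>x. x \<notin> \<Omega> \<longrightarrow> f x = 0) \<and> (\<Sum>x\<in>\<Omega>. (f x)\<^sup>2) = 1}"
  obtain z where "z \<in> \<Omega>" using interior_nonempty by auto
  moreover have "(\<Sum>x\<in>\<Omega>. (if x = z then 1 else 0 :: real)\<^sup>2) = (\<Sum>x\<in>\<Omega>. if x = z then 1 else 0)"
    by (intro sum.cong) auto
  ultimately have "(\<lambda>x. if x = z then 1 else 0) \<in> ?K"
    using finite_interior by auto
  then have "?K \<noteq> {}" by (metis empty_iff)
  moreover have "continuous_on ?K (\<lambda>f. dirichlet_form G f f)"
    unfolding dirichlet_form_def case_prod_unfold
    by (intro continuous_intros continuous_on_subset[OF continuous_on_product_coordinates]) auto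
  ultimately have "\<exists>f\<in>?K. \<forall>g\<in>?K. dirichlet_form G f f \<le> dirichlet_form G g g"
    by (intro continuous_attains_inf[OF compact_unit_sphere])
  then obtain f where f: "f \<in> ?K"
    and min: "\<And>g. g \<in> ?K \<Longrightarrow> dirichlet_form G f f \<le> dirichlet_form G g g"
    by (elim bexE) (erule that, erule (1) bspec)
  have "dirichlet_form G f f * (\<Sum>x\<in>\<Omega>. (g x)\<^sup>2) \<le> dirichlet_form G g g"
    if g: "\<And>x. x \<in> B \<Longrightarrow> g x = 0" for g
  proof (cases "(\<Sum>x\<in>\<Omega>. (g x)\<^sup>2) = 0")
    case False
    define s where "s = (\<Sum>x\<in>\<Omega>. (g x)\<^sup>2)"
    have s: "s > 0" using False unfolding s_def by (simp add: order_less_le sum_nonneg)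
    \<comment> \<open>Besides normalising, \<open>h\<close> cuts off the arbitrary values of
      \<open>g\<close> outside the graph, as membership in \<open>?K\<close> demands; the energy
      does not see them.\<close>
    define h where "h x = (if x \<in> \<Omega> then 1 / sqrt s * g x else 0)" for x
    have "(\<Sum>x\<in>\<Omega>. (h x)\<^sup>2) = (\<Sum>x\<in>\<Omega>. (g x)\<^sup>2) / s"
      using s unfolding h_def sum_divide_distrib
      by (intro sum.cong) (auto simp: power_divide)
    then have "h \<in> ?K" using s by (auto simp: h_def s_def)
    then have "dirichlet_form G f f \<le> dirichlet_form G h h" by (rule min)
    also have "dirichlet_form G h h = dirichlet_form G (\<lambda>x. 1 / sqrt s * g x) (\<lambda>x. 1 / sqrt s * g x)"
    proof -
      have "h x = 1 / sqrt s * g x" if "x \<in> verts G" for x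
        using that g by (auto simp: h_def interior_verts_def)
      then show ?thesis
        unfolding dirichlet_form_def
        by (intro arg_cong2[where f = "(/)"] sum.cong) (auto dest: adj_in_verts)
    qed
    also have "\<dots> = dirichlet_form G g g / s"
      using s unfolding dirichlet_form_scale by (simp add: power_divide)
    finally show ?thesis using s by (simp add: field_simps s_def)
  qed (simp add: dirichlet_form_nonneg)
  then show ?thesis using f that by blast
qed

text \<open>Green's formula with \<open>g = f\<close>: boundary terms vanish with \<open>f\<close>,
  and the eigenvalue equation applies in the interior.\<close>

lemma eigenfunction_rayleigh:
  assumes B: "\<And>x. x \<in> B \<Longrightarrow> f x = 0"
    and f: "\<And>x. x \<in> \<Omega> \<Longrightarrow> laplacian G f x = l * f x"
  shows "dirichlet_form G f f = l * (\<Sum>x\<in>\<Omega>. (f x)\<^sup>2)"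
proof -
  have "dirichlet_form G f f = (\<Sum>x\<in>\<Omega>. f x * laplacian G f x)"
    by (subst sum_interior[symmetric]) (auto simp: sum_mult_laplacian B)
  also have "\<dots> = l * (\<Sum>x\<in>\<Omega>. (f x)\<^sup>2)"
    unfolding sum_distrib_left by (intro sum.cong) (auto simp: f power2_eq_square)
  finally show ?thesis .
qed

lemma dirichlet_eigenvalueE:
  assumes "dirichlet_eigenvalue G B l"
  obtains f where "\<And>x. x \<in> B \<Longrightarrow> f x = 0" "0 < (\<Sum>x\<in>\<Omega>. (f x)\<^sup>2)"
    "dirichlet_form G f f = l * (\<Sum>x\<in>\<Omega>. (f x)\<^sup>2)"
proof -
  obtain f z where f: "z \<in> verts G" "f z \<noteq> 0" "\<And>x. x \<in> B \<Longrightarrow> f x = 0"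
    "\<And>x. x \<in> \<Omega> \<Longrightarrow> laplacian G f x = l * f x"
    using assms unfolding dirichlet_eigenvalue_def laplacian_def by auto
  then have "0 < (\<Sum>x\<in>\<Omega>. (f x)\<^sup>2)"
    using finite_interior by (intro sum_pos2[of _ z]) (auto simp: interior_verts_def)
  then show ?thesis using that f(3) eigenfunction_rayleigh[of f l] f(4) by blast
qed

text \<open>\<open>LEAST\<close> over the reals is informative only if a least element exists. The
  Rayleigh minimum \<open>m\<close> is an eigenvalue, and every eigenvalue is the Rayleigh quotient
  of an admissible function, so none lies below \<open>m\<close>.\<close>

lemma
  shows first_dirichlet_eigenvalue: "dirichlet_eigenvalue G B (first_dirichlet_eigenvalue G B)"
    and first_dirichlet_eigenvalue_le: "\<And>g. (\<And>x. x \<in> B \<Longrightarrow> g x = 0) \<Longrightarrow>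
      first_dirichlet_eigenvalue G B * (\<Sum>x\<in>\<Omega>. (g x)\<^sup>2) \<le> dirichlet_form G g g"
proof -
  obtain f where f: "\<And>x. x \<notin> \<Omega> \<Longrightarrow> f x = 0" "(\<Sum>x\<in>\<Omega>. (f x)\<^sup>2) = 1"
    and min: "\<And>g. (\<And>x. x \<in> B \<Longrightarrow> g x = 0) \<Longrightarrow>
      dirichlet_form G f f * (\<Sum>x\<in>\<Omega>. (g x)\<^sup>2) \<le> dirichlet_form G g g"
    using rayleigh_minimizer by metis
  define m where "m = dirichlet_form G f f"
  have fB: "f x = 0" if "x \<in> B" for x
    using that f(1) by (auto simp: interior_verts_def)
  have eq: "laplacian G f z = m * f z" if z: "z \<in> \<Omega>" for z
  proof -
    \<comment> \<open>first variation of the Rayleigh quotient in the direction of the indicator of \<open>z\<close>\<close>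
    define d where "d x = (if x = z then 1 else 0 :: real)" for x
    have zV: "z \<in> verts G" "z \<notin> B" using z by (auto simp: interior_verts_def)
    \<comment> \<open>By Green's formula, pairing with the indicator reads off the Laplacian at
      \<open>z\<close>.\<close>
    have Df: "dirichlet_form G f d = laplacian G f z"
      unfolding sum_mult_laplacian[symmetric] d_def using zV
      by (simp add: if_distrib[of "\<lambda>c. c * _"] cong: if_cong)
    \<comment> \<open>Minimality tested on \<open>f + t * d\<close>; the constant terms cancel
      because \<open>f\<close> has norm 1 and energy \<open>m\<close>.\<close>
    have "0 \<le> 2 * t * (laplacian G f z - m * f z) + t\<^sup>2 * (dirichlet_form G d d - m)" for t
    proof -
      have "(\<Sum>x\<in>\<Omega>. (f x + t * d x)\<^sup>2) = (\<Sum>x\<in>\<Omega>. (f x)\<^sup>2 + (if x = z then 2 * t * f x + t\<^sup>2 else 0))"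
        by (intro sum.cong) (auto simp: d_def power2_eq_square algebra_simps)
      also have "\<dots> = 1 + 2 * t * f z + t\<^sup>2"
        using z finite_interior f(2) by (simp add: sum.distrib)
      finally have "m * (1 + 2 * t * f z + t\<^sup>2) \<le> m + 2 * t * laplacian G f z + t\<^sup>2 * dirichlet_form G d d"
        using min[of "\<lambda>x. f x + t * d x"] zV fB
        unfolding dirichlet_form_add_scale Df m_def by (metis (no_types, lifting) add_0 d_def mult_zero_right)
      then show ?thesis by (simp add: algebra_simps)
    qed
    then show ?thesis using linear_coeff_zero by fastforce
  qed
  have "\<exists>x\<in>verts G. f x \<noteq> 0"
  proof (rule ccontr)
    assume "\<not> ?thesis"
    then have "(\<Sum>x\<in>\<Omega>. (f x)\<^sup>2) = 0" by (simp add: interior_verts_def)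
    then show False using f(2) by simp
  qed
  then have ev: "dirichlet_eigenvalue G B m"
    using fB eq unfolding dirichlet_eigenvalue_def laplacian_def by blast
  have "m \<le> l" if "dirichlet_eigenvalue G B l" for l
    using that
  proof (rule dirichlet_eigenvalueE)
    fix g assume "\<And>x. x \<in> B \<Longrightarrow> g x = 0" "0 < (\<Sum>x\<in>\<Omega>. (g x)\<^sup>2)"
      "dirichlet_form G g g = l * (\<Sum>x\<in>\<Omega>. (g x)\<^sup>2)"
    then show ?thesis using min[of g] by (simp add: m_def)
  qed
  then have "first_dirichlet_eigenvalue G B = m"
    unfolding first_dirichlet_eigenvalue_def using ev by (intro Least_equality)
  then show "dirichlet_eigenvalue G B (first_dirichlet_eigenvalue G B)"
    "\<And>g. (\<And>x. x \<in> B \<Longrightarrow> g x = 0) \<Longrightarrow>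
      first_dirichlet_eigenvalue G B * (\<Sum>x\<in>\<Omega>. (g x)\<^sup>2) \<le> dirichlet_form G g g"
    using ev min m_def by auto
qed

section \<open>The lower bound for the first eigenvalue\<close>

lemma first_dirichlet_eigenvalue_nonneg: "0 \<le> first_dirichlet_eigenvalue G B"
  using first_dirichlet_eigenvalue
proof (rule dirichlet_eigenvalueE)
  fix f assume "0 < (\<Sum>x\<in>\<Omega>. (f x)\<^sup>2)"
    "dirichlet_form G f f = first_dirichlet_eigenvalue G B * (\<Sum>x\<in>\<Omega>. (f x)\<^sup>2)"
  then show ?thesis using dirichlet_form_nonneg[of G f] by (simp add: zero_le_mult_iff)
qed

text \<open>\<open>v\<close> maximises the square of an eigenfunction, and the path estimate is
  divided by that maximum. The product form avoids dividing by the eigenvalue, whose positivity is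
  still open here.\<close>

lemma apath_to_boundary_length:
  obtains v where "v \<in> \<Omega>"
    "\<And>b p. b \<in> B \<Longrightarrow> apath v p b \<Longrightarrow>
      1 \<le> real (length p) * (first_dirichlet_eigenvalue G B * real (card \<Omega>))"
  using first_dirichlet_eigenvalue
proof (rule dirichlet_eigenvalueE)
  let ?l = "first_dirichlet_eigenvalue G B"
  fix f assume fB: "\<And>x. x \<in> B \<Longrightarrow> f x = 0" and pos: "0 < (\<Sum>x\<in>\<Omega>. (f x)\<^sup>2)"
    and D: "dirichlet_form G f f = ?l * (\<Sum>x\<in>\<Omega>. (f x)\<^sup>2)"
  let ?M = "Max ((\<lambda>x. (f x)\<^sup>2) ` \<Omega>)"
  have "?M \<in> (\<lambda>x. (f x)\<^sup>2) ` \<Omega>"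
    using finite_interior interior_nonempty by (intro Max_in) auto
  then obtain v where v: "v \<in> \<Omega>" "(f v)\<^sup>2 = ?M" by auto
  have le: "(\<Sum>x\<in>\<Omega>. (f x)\<^sup>2) \<le> real (card \<Omega>) * (f v)\<^sup>2"
    using finite_interior v by (intro sum_bounded_above) auto
  then have fv: "0 < (f v)\<^sup>2"
    using pos by (metis less_le_trans mult_zero_right zero_le_power2 order_less_le)
  have "1 \<le> real (length p) * (?l * real (card \<Omega>))" if "b \<in> B" "apath v p b" for b p
  proof -
    have "(f v)\<^sup>2 \<le> real (length p) * (?l * (\<Sum>x\<in>\<Omega>. (f x)\<^sup>2))"
      using apath_diff_squared_le[OF that(2), of f] fB[OF that(1)] D by simp
    also have "\<dots> \<le> real (length p) * (?l * (real (card \<Omega>) * (f v)\<^sup>2))"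
      using le first_dirichlet_eigenvalue_nonneg by (intro mult_left_mono) auto
    finally have "1 * (f v)\<^sup>2 \<le> (real (length p) * (?l * real (card \<Omega>))) * (f v)\<^sup>2"
      by (simp add: mult_ac)
    then show ?thesis using fv by (simp only: mult_le_cancel_right_pos)
  qed
  then show ?thesis using that v(1) by blast
qed

lemma inscribed_radius_ge:
  assumes "v \<in> verts G" "\<And>b. b \<in> B \<Longrightarrow> c \<le> graph_dist G v b"
  shows "c \<le> inscribed_radius G B"
  unfolding inscribed_radius_def using assms by (intro SUP_upper2[of v] INF_greatest)

lemma first_dirichlet_eigenvalue_lower_bound:
  "1 / (inscribed_radius G B * ereal (real (card \<Omega>))) \<le> ereal (first_dirichlet_eigenvalue G B)"
proof -
  let ?l = "first_dirichlet_eigenvalue G B" and ?r = "inscribed_radius G B" and ?n = "real (card \<Omega>)"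
  have n: "?n > 0" using card_interior_pos by simp
  obtain v where v: "v \<in> \<Omega>"
    and len: "\<And>b p. b \<in> B \<Longrightarrow> apath v p b \<Longrightarrow> 1 \<le> real (length p) * (?l * ?n)"
    using apath_to_boundary_length by blast
  have vV: "v \<in> verts G" using v by (simp add: interior_verts_def)
  \<comment> \<open>Keeping \<open>c\<close> free treats a zero eigenvalue uniformly: every
    nonnegative \<open>c\<close> would then be a lower bound of the radius.\<close>
  have ge: "ereal c \<le> ?r" if "c * (?l * ?n) \<le> 1" "0 \<le> c" for c
  proof (intro inscribed_radius_ge[OF vV] graph_dist_ge)
    fix b p assume "b \<in> B" "apath v p b"
    then have "1 \<le> real (length p) * (?l * ?n)" by (rule len)
    then have l: "0 < ?l * ?n"
      using first_dirichlet_eigenvalue_nonneg n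
      by (metis mult_zero_right not_one_le_zero order_less_le zero_le_mult_iff)
    then show "c \<le> real (length p)"
      using \<open>1 \<le> _\<close> that(1) by (meson mult_le_cancel_right_pos order_trans)
  qed
  show ?thesis
  proof (cases ?r)
    case (real r)
    have l: "0 < ?l"
    proof (rule ccontr)
      assume "\<not> 0 < ?l"
      then have "?l = 0" using first_dirichlet_eigenvalue_nonneg by simp
      \<comment> \<open>A zero eigenvalue would push the finite radius above itself.\<close>
      then show False using ge[of "\<bar>r\<bar> + 1"] real by simp
    qed
    then have *: "1 / (?l * ?n) \<le> r" using ge[of "1 / (?l * ?n)"] n real by simp
    moreover have "0 < 1 / (?l * ?n)" using l n by simp
    ultimately have r: "0 < r" by linarith
    have "1 / (r * ?n) \<le> ?l" using * l n r by (simp add: field_simps)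
    then show ?thesis using real r n by (simp add: one_ereal_def)
  next
    case PInf
    \<comment> \<open>The reciprocal of infinity is 0, so nonnegativity of the eigenvalue
      suffices.\<close>
    then show ?thesis using n first_dirichlet_eigenvalue_nonneg by simp
  next
    case MInf
    then show ?thesis using ge[of 0] by simp
  qed
qed

section \<open>Comparison of radius and diameter\<close>

lemma inscribed_radius_le_diameter: "inscribed_radius G B \<le> graph_diameter G"
proof -
  obtain b where b: "b \<in> B" "b \<in> verts G" using boundary_nonempty boundary_subset by auto
  then show ?thesis
    unfolding inscribed_radius_def graph_diameter_def
    by (intro SUP_mono') (blast intro: INF_lower2 SUP_upper2)
qed

text \<open>A path from the interior to the boundary has at least one arc. Positivity supplies the
  sign condition under which reciprocals reverse the inequality.\<close>

lemma inscribed_radius_pos: "0 < inscribed_radius G B"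
proof -
  obtain v where v: "v \<in> \<Omega>" using interior_nonempty by auto
  have "ereal 1 \<le> inscribed_radius G B"
  proof (intro inscribed_radius_ge graph_dist_ge)
    fix b p assume "b \<in> B" "apath v p b"
    then have "p \<noteq> []" using v by (auto simp: apath_Nil_iff interior_verts_def)
    then show "1 \<le> real (length p)" by (cases p) auto
  qed (use v in \<open>auto simp: interior_verts_def\<close>)
  then show ?thesis by (rule less_le_trans[rotated]) simp
qed

lemma inverse_radius_ge_inverse_diameter:
  "1 / (graph_diameter G * ereal (real (card \<Omega>))) \<le> 1 / (inscribed_radius G B * ereal (real (card \<Omega>)))"
proof -
  have "0 < inscribed_radius G B * ereal (real (card \<Omega>))"
    using inscribed_radius_pos card_interior_pos by (simp add: ereal_zero_less_0_iff)
  moreover have "inscribed_radius G B * ereal (real (card \<Omega>)) \<le> graph_diameter G * ereal (real (card \<Omega>))"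
    using inscribed_radius_le_diameter by (intro ereal_mult_right_mono) auto
  ultimately show ?thesis
    by (simp add: divide_ereal_def ereal_inverse_antimono)
qed

end

section \<open>Sharpness: tools for distances and sums\<close>

lemma (in graph) graph_dist_le_relpow:
  assumes "(u, v) \<in> arcs_ends G ^^ k" "u \<in> verts G"
  shows "graph_dist G u v \<le> ereal (real k)"
proof -
  have "\<exists>p. awalk u p v \<and> length p = k"
    using assms
  proof (induction k arbitrary: v)
    case 0
    then show ?case by (auto simp: awalk_Nil_iff)
  next
    case (Suc k)
    then obtain w p where "awalk u p w" "length p = k" "w \<rightarrow> v"
      by (metis relpow_Suc_E)
    moreover from \<open>w \<rightarrow> v\<close> obtain e where "e \<in> arcs G" "tail G e = w" "head G e = v" by auto
    ultimately have "awalk u (p @ [e]) v \<and> length (p @ [e]) = Suc k"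
      by (auto simp: awalk_simps)
    then show ?case by blast
  qed
  then obtain p where "awalk u p v" "length p = k" by blast
  then show ?thesis
    using min_cost_le_walk_cost[of u p v "\<lambda>_. 1"] by (simp add: graph_dist_def awalk_cost_one)
qed

text \<open>Each arc lowers \<open>h\<close> by at most 1, so the total drop bounds the length of
  any path from below.\<close>

lemma (in fin_digraph) graph_dist_ge_lipschitz:
  assumes "\<And>x y. x \<rightarrow> y \<Longrightarrow> (h x :: real) \<le> h y + 1"
  shows "ereal (h u - h v) \<le> graph_dist G u v"
proof (rule graph_dist_ge)
  fix p assume "apath u p v"
  then have "awalk u p v" by (simp add: apath_def)
  then show "h u - h v \<le> real (length p)"
  proof (induction p arbitrary: u)
    case (Cons a p)
    then have "tail G a \<rightarrow> head G a" "u = tail G a" "h (head G a) - h v \<le> real (length p)"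
      by (auto simp: awalk_Cons_iff intro: in_arcs_imp_in_arcs_ends)
    then show ?case using assms[of "tail G a" "head G a"] by simp
  qed (auto simp: awalk_Nil_iff)
qed

text \<open>Bounds below the squared norm of the test function on the broom. The first
  \<open>m\<close> squares sum to \<open>m * (m + 1) * (2 * m + 1) / 6\<close>, and each further
  term \<open>m\<^sup>2\<close> is at least \<open>m * (m + 1) / 3\<close>.\<close>

lemma sum_min_squares_ge:
  "m \<le> n \<Longrightarrow> n * m * (m + 1) \<le> 3 * (\<Sum>j=1..n. (min j m)\<^sup>2)" for m n :: nat
proof (induction n rule: nat_induct_at_least)
  case base
  have "k * k * (k + 1) \<le> 3 * (\<Sum>j=1..k. j\<^sup>2)" for k :: nat
    by (induction k) (auto simp: algebra_simps power2_eq_square)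
  then have "m * m * (m + 1) \<le> 3 * (\<Sum>j=1..m. j\<^sup>2)" .
  also have "(\<Sum>j=1..m. j\<^sup>2) = (\<Sum>j=1..m. (min j m)\<^sup>2)"
    by (intro sum.cong) auto
  finally show ?case .
next
  case (Suc n)
  have "m * (m + 1) \<le> 3 * m\<^sup>2" by (cases m) (auto simp: power2_eq_square)
  moreover have "(\<Sum>j=1..Suc n. (min j m)\<^sup>2) = (\<Sum>j=1..n. (min j m)\<^sup>2) + m\<^sup>2"
    using Suc.hyps by simp
  moreover have "Suc n * m * (m + 1) = n * m * (m + 1) + m * (m + 1)" by (simp add: algebra_simps)
  ultimately show ?case using Suc.IH by linarith
qed

text \<open>The broom: a path \<open>0, \<dots>, r - 1\<close> whose end \<open>r - 1\<close> carries the leaves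
  \<open>r, \<dots>, n\<close>; the only boundary vertex is \<open>0\<close>.\<close>

definition broom_parent :: "nat \<Rightarrow> nat \<Rightarrow> nat" where
  "broom_parent r j = min (j - 1) (r - 1)"

definition broom :: "nat \<Rightarrow> nat \<Rightarrow> (nat, nat \<times> nat) pre_digraph" where
  "broom r n = \<lparr>verts = {0..n},
    arcs = (\<lambda>j. (j, broom_parent r j)) ` {1..n} \<union> (\<lambda>j. (broom_parent r j, j)) ` {1..n},
    tail = fst, head = snd\<rparr>"

section \<open>The broom as a graph with connected interior\<close>

lemma broom_parent_less: "1 \<le> j \<Longrightarrow> broom_parent r j < j"
  by (auto simp: broom_parent_def)

lemma broom_simps [simp]:
  "verts (broom r n) = {0..n}" "tail (broom r n) = fst" "head (broom r n) = snd"
  by (simp_all add: broom_def)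

lemma broom_arcs: "arcs (broom r n) = arcs_ends (broom r n)"
  by (simp add: arcs_ends_conv)

lemma broom_adj_iff:
  "u \<rightarrow>\<^bsub>broom r n\<^esub> v \<longleftrightarrow>
    1 \<le> u \<and> u \<le> n \<and> v = broom_parent r u \<or> 1 \<le> v \<and> v \<le> n \<and> u = broom_parent r v"
  by (auto simp: broom_def arcs_ends_conv image_iff)

lemma broom_adj_verts:
  assumes "u \<rightarrow>\<^bsub>broom r n\<^esub> v"
  shows "u \<le> n" "v \<le> n" "u \<noteq> v"
  using assms broom_parent_less[of u r] broom_parent_less[of v r]
  unfolding broom_adj_iff by auto

text \<open>Arcs are literally pairs of vertices, which excludes parallel arcs; a parent is smaller
  than its child, which excludes loops.\<close>

lemma graph_broom: "graph (broom r n)"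
proof
  show "finite (arcs (broom r n))" by (simp add: broom_def)
  show "symmetric (broom r n)"
    unfolding symmetric_def sym_def broom_adj_iff by blast
qed (auto simp: broom_arcs arc_to_ends_def dest: broom_adj_verts)

lemma interior_broom: "interior_verts (broom r n) {0} = {1..n}"
  by (auto simp: interior_verts_def)

lemma graph_with_boundary_broom:
  assumes "1 \<le> n"
  shows "graph_with_boundary (broom r n) {0}"
proof -
  interpret graph "broom r n" by (rule graph_broom)
  have "0 \<rightarrow>\<^bsub>broom r n\<^esub> 1"
    using assms by (simp add: broom_adj_iff broom_parent_def)
  then show ?thesis
    using assms
    by unfold_locales (auto simp: interior_broom dest: broom_adj_verts(3) intro!: bexI[of _ 1])
qed

text \<open>Following parents leads from every interior vertex down to 1. As \<open>r\<close> is at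
  least 2, the parent of any \<open>j > 1\<close> is again at least 1, so the descent avoids the
  boundary vertex 0.\<close>

lemma connected_interior_broom:
  assumes "2 \<le> r" "1 \<le> n"
  shows "Digraph_Component.connected (broom r n \<restriction> interior_verts (broom r n) {0})"
proof -
  let ?R = "(arcs_ends (broom r n \<restriction> {1..n}))\<^sup>s"
  let ?T = "rtrancl_on {1..n} ?R"
  have "sym ?T" by (intro rtrancl_on_sym) (auto simp: sym_def symcl_def)
  have "(j, 1) \<in> ?T" if "1 \<le> j" "j \<le> n" for j
    using that
  proof (induction j rule: less_induct)
    case (less j)
    show ?case
    proof (cases "j = 1")
      case False
      let ?p = "broom_parent r j"
      have p: "1 \<le> ?p" "?p < j" using less False assms by (auto simp: broom_parent_def)
      then have "(j, ?p) \<in> arcs (broom r n)"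
        using less by (auto simp: broom_arcs broom_adj_iff)
      then have "(j, ?p) \<in> ?R"
        using p less by (auto simp: arcs_ends_conv image_iff symcl_def)
      moreover have "(?p, 1) \<in> ?T" using less p by auto
      ultimately show ?thesis
        using less.prems by (metis atLeastAtMost_iff converse_rtrancl_on_into_rtrancl_on)
    qed (use assms in auto)
  qed
  then have "(u, v) \<in> ?T" if "u \<in> {1..n}" "v \<in> {1..n}" for u v
    using that \<open>sym ?T\<close> by (meson atLeastAtMost_iff rtrancl_on_trans symE)
  then show ?thesis
    using assms unfolding interior_broom by (simp add: connected_conv)
qed

section \<open>Distances in the broom\<close>

text \<open>\<open>min j r\<close> is the depth of \<open>j\<close>, and passing to the parent
  lowers it by exactly one. A vertex \<open>i < r\<close> lies on the path and is an ancestor of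
  every \<open>j\<close> from \<open>i\<close> on.\<close>

lemma broom_relpow:
  assumes "i < r" "i \<le> j" "j \<le> n"
  shows "(j, i) \<in> arcs_ends (broom r n) ^^ (min j r - i)"
  using assms
proof (induction j rule: less_induct)
  case (less j)
  show ?case
  proof (cases "i = j")
    case False
    let ?p = "broom_parent r j"
    have p: "i \<le> ?p" "?p < j" "min j r - i = Suc (min ?p r - i)"
      using less.prems False by (auto simp: broom_parent_def)
    have "(j, ?p) \<in> arcs_ends (broom r n)"
      using less.prems False by (auto simp: broom_adj_iff)
    moreover have "(?p, i) \<in> arcs_ends (broom r n) ^^ (min ?p r - i)"
      using less.IH[OF p(2) less.prems(1) p(1)] p(2) less.prems(3) by linarith
    ultimately show ?thesis unfolding p(3) by (rule relpow_Suc_I2)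
  qed (use less in auto)
qed

lemma sym_relpow: "sym R \<Longrightarrow> sym (R ^^ k)"
proof (induction k)
  case (Suc k)
  show ?case
  proof (rule symI)
    fix x z assume "(x, z) \<in> R ^^ Suc k"
    then obtain y where "(x, y) \<in> R ^^ k" "(y, z) \<in> R" by auto
    then show "(z, x) \<in> R ^^ Suc k"
      using Suc by (meson relpow_Suc_I2 symD)
  qed
qed (auto simp: sym_def)

lemma broom_dist_le:
  assumes r: "2 \<le> r" and uv: "u \<le> n" "v \<le> n"
  shows "graph_dist (broom r n) u v \<le> ereal (real r)"
proof -
  interpret graph "broom r n" by (rule graph_broom)
  let ?A = "arcs_ends (broom r n)"
  have sym: "sym (?A ^^ k)" for k
    using sym_arcs by (intro sym_relpow) (simp add: symmetric_def)
  \<comment> \<open>By symmetry the smaller vertex comes first. Either it is an ancestor of the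
    other, or both are leaves joined by two steps through \<open>r - 1\<close>; the latter uses that
    \<open>r\<close> is at least 2.\<close>
  have "\<exists>k\<le>r. (i, j) \<in> ?A ^^ k" if "i \<le> j" "j \<le> n" for i j
  proof (cases "i < r")
    case True
    then have "(i, j) \<in> ?A ^^ (min j r - i)"
      using broom_relpow that sym by (blast dest: symD)
    moreover have "min j r - i \<le> r" by simp
    ultimately show ?thesis by blast
  next
    case False
    then have "broom_parent r i = r - 1" "broom_parent r j = r - 1"
      using that by (auto simp: broom_parent_def)
    then have "(i, r - 1) \<in> ?A" "(r - 1, j) \<in> ?A"
      using that False r unfolding broom_adj_iff by auto
    then have "(i, j) \<in> ?A ^^ 2" by (auto simp: numeral_2_eq_2)
    then show ?thesis using r by blast
  qed
  then obtain k where "k \<le> r" "(u, v) \<in> ?A ^^ k"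
    using uv sym by (metis nat_le_linear symD)
  then show ?thesis
    using graph_dist_le_relpow[of u v k] uv by (auto elim: order_trans)
qed

text \<open>The depth \<open>min j r\<close> changes by at most 1 along an arc, and \<open>r\<close>
  is the first leaf, at depth \<open>r\<close>.\<close>

lemma broom_dist_ge:
  assumes "r \<le> n"
  shows "ereal (real r) \<le> graph_dist (broom r n) r 0"
proof -
  interpret graph "broom r n" by (rule graph_broom)
  have "ereal (real (min r r) - real (min 0 r)) \<le> graph_dist (broom r n) r 0"
    by (rule graph_dist_ge_lipschitz) (auto simp: broom_adj_iff broom_parent_def)
  then show ?thesis by simp
qed

lemma inscribed_radius_broom:
  assumes "2 \<le> r" "r \<le> n"
  shows "inscribed_radius (broom r n) {0} = ereal (real r)"
  unfolding inscribed_radius_def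
  using assms broom_dist_le[of r _ n 0] broom_dist_ge[of r n]
  by (intro antisym SUP_least SUP_upper2[of r]) auto

lemma graph_diameter_broom:
  assumes "2 \<le> r" "r \<le> n"
  shows "graph_diameter (broom r n) = ereal (real r)"
proof (rule antisym)
  show "graph_diameter (broom r n) \<le> ereal (real r)"
    unfolding graph_diameter_def using assms by (intro SUP_least broom_dist_le) auto
  have "graph_dist (broom r n) r 0 \<le> graph_diameter (broom r n)"
    unfolding graph_diameter_def using assms by (intro SUP_upper2[of r] SUP_upper) auto
  then show "ereal (real r) \<le> graph_diameter (broom r n)"
    using broom_dist_ge[OF assms(2)] by (rule order_trans[rotated])
qed

text \<open>Only the path edges contribute, since all leaves share the value of \<open>r - 1\<close>.\<close>

lemma dirichlet_form_broom_le:
  fixes r n :: nat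
  defines "g \<equiv> (\<lambda>j. real (min j (r - 1)))"
  shows "dirichlet_form (broom r n) g g \<le> real (r - 1)"
proof -
  interpret graph "broom r n" by (rule graph_broom)
  let ?A = "arcs_ends (broom r n)" and ?S = "(\<lambda>j. (j, broom_parent r j)) ` {1..r - 1}"
  let ?h = "\<lambda>(x, y). (max 0 (g x - g y))\<^sup>2"
  have zero: "?h e = 0" if "e \<in> ?A - ?S" for e
    using that by (cases e) (fastforce simp: broom_adj_iff broom_parent_def g_def)
  have "dirichlet_form (broom r n) g g = sum ?h ?A"
    by (simp add: dirichlet_form_positive_part)
  \<comment> \<open>\<open>?S\<close> holds the path edges oriented towards 0, the only direction in
    which \<open>g\<close> drops. The intersection is taken because \<open>r - 1\<close> may exceed
    \<open>n\<close> here.\<close>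
  also have "\<dots> = sum ?h (?A \<inter> ?S)"
    using zero by (intro sum.mono_neutral_right finite_arcs_ends) auto
  also have "\<dots> \<le> sum ?h ?S"
    by (intro sum_mono2) auto
  also have "\<dots> \<le> (\<Sum>e\<in>?S. 1)"
    by (intro sum_mono) (auto simp: g_def broom_parent_def)
  also have "\<dots> \<le> real (r - 1)"
    using card_image_le[of "{1..r - 1}" "\<lambda>j. (j, broom_parent r j)"] by simp
  finally show ?thesis .
qed

section \<open>The eigenvalue of the broom and the theorem\<close>

text \<open>With \<open>m = r - 1\<close>, the test function \<open>min j m\<close> has energy at
  most \<open>m\<close> and squared norm at least \<open>n * m * r / 3\<close>; the factor
  \<open>m\<close> cancels in the quotient.\<close>

lemma first_dirichlet_eigenvalue_broom_le:
  assumes r: "2 \<le> r" "r \<le> n"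
  shows "first_dirichlet_eigenvalue (broom r n) {0} \<le> 3 / (real r * real n)"
proof -
  interpret graph_with_boundary "broom r n" "{0}"
    using r by (intro graph_with_boundary_broom) auto
  let ?l = "first_dirichlet_eigenvalue (broom r n) {0}"
  define m where "m = r - 1"
  have m: "1 \<le> m" "r = m + 1" "m \<le> n" using r by (auto simp: m_def)
  have "?l * (real n * real m * real r) \<le> ?l * (3 * (\<Sum>j\<in>\<Omega>. (real (min j m))\<^sup>2))"
  proof (intro mult_left_mono first_dirichlet_eigenvalue_nonneg)
    have "real (n * m * (m + 1)) \<le> real (3 * (\<Sum>j=1..n. (min j m)\<^sup>2))"
      using sum_min_squares_ge[OF m(3)] by (simp only: of_nat_le_iff)
    then show "real n * real m * real r \<le> 3 * (\<Sum>j\<in>\<Omega>. (real (min j m))\<^sup>2)"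
      by (simp add: interior_broom m(2) distrib_left)
  qed
  also have "\<dots> \<le> 3 * real m"
    using first_dirichlet_eigenvalue_le[of "\<lambda>j. real (min j m)"] dirichlet_form_broom_le[of r n]
    by (auto simp: m_def)
  finally have "(?l * (real r * real n)) * real m \<le> 3 * real m"
    by (simp add: mult_ac)
  then have "?l * (real r * real n) \<le> 3" using m by simp
  then show ?thesis using r by (simp add: pos_le_divide_eq)
qed

text \<open>Sharpness is expressed by one constant that serves all admissible \<open>r\<close> and
  \<open>n\<close>; radius and diameter agree in the examples, so both lower bounds are tested at
  once.\<close>

theorem theorem1p1:
  shows "(\<forall>(G :: ('a, 'b) pre_digraph) B.
      graph_with_boundary G B \<longrightarrow>
      Digraph_Component.connected (G \<restriction> interior_verts G B) \<longrightarrow>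
        ereal (first_dirichlet_eigenvalue G B)
          \<ge> 1 / (inscribed_radius G B * ereal (real (card (interior_verts G B)))) \<and>
        1 / (inscribed_radius G B * ereal (real (card (interior_verts G B))))
          \<ge> 1 / (graph_diameter G * ereal (real (card (interior_verts G B)))))
    \<and> (\<exists>C > 0. \<forall>(r :: nat) (n :: nat). 2 \<le> r \<and> r \<le> n \<longrightarrow>
        (\<exists>(G :: (nat, nat \<times> nat) pre_digraph) B.
          graph_with_boundary G B \<and>
          Digraph_Component.connected (G \<restriction> interior_verts G B) \<and>
          card (interior_verts G B) = n \<and>
          inscribed_radius G B = ereal (real r) \<and>
          graph_diameter G = ereal (real r) \<and>
          first_dirichlet_eigenvalue G B \<le> C / (real r * real n)))"
proof (intro conjI allI impI)
  fix G :: "('a, 'b) pre_digraph" and B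
  assume "graph_with_boundary G B"
  then interpret graph_with_boundary G B .
  show "1 / (inscribed_radius G B * ereal (real (card (interior_verts G B))))
      \<le> ereal (first_dirichlet_eigenvalue G B)"
    by (rule first_dirichlet_eigenvalue_lower_bound)
  show "1 / (graph_diameter G * ereal (real (card (interior_verts G B))))
      \<le> 1 / (inscribed_radius G B * ereal (real (card (interior_verts G B))))"
    by (rule inverse_radius_ge_inverse_diameter)
next
  show "\<exists>C > 0. \<forall>(r :: nat) (n :: nat). 2 \<le> r \<and> r \<le> n \<longrightarrow>
        (\<exists>(G :: (nat, nat \<times> nat) pre_digraph) B.
          graph_with_boundary G B \<and>
          Digraph_Component.connected (G \<restriction> interior_verts G B) \<and>
          card (interior_verts G B) = n \<and>
          inscribed_radius G B = ereal (real r) \<and>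
          graph_diameter G = ereal (real r) \<and>
          first_dirichlet_eigenvalue G B \<le> C / (real r * real n))"
  \<comment> \<open>The constant 3 stems from the lower bound on the sum of squares.\<close>
  proof (intro exI[of _ "3::real"] conjI allI impI)
    fix r n :: nat
    assume "2 \<le> r \<and> r \<le> n"
    then show "\<exists>(G :: (nat, nat \<times> nat) pre_digraph) B.
          graph_with_boundary G B \<and>
          Digraph_Component.connected (G \<restriction> interior_verts G B) \<and>
          card (interior_verts G B) = n \<and>
          inscribed_radius G B = ereal (real r) \<and>
          graph_diameter G = ereal (real r) \<and>
          first_dirichlet_eigenvalue G B \<le> 3 / (real r * real n)"
      by (intro exI[of _ "broom r n"] exI[of _ "{0}"] conjI graph_with_boundary_broom
          connected_interior_broom inscribed_radius_broom graph_diameter_broom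
          first_dirichlet_eigenvalue_broom_le) (auto simp: interior_broom)
  qed simp
qed

end
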